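(* Let $\mathcal V=\{V_i\}_{i\in P}$ be a set of views that explains a strongly causal consistent execution. For each process $i\in P$ let $$R_i=\widehat{V}_i\setminus\bigl(SCO_i(\mathcal V)\cup PO\cup B_i(\mathcal V)\bigr),$$ where the union is the plain set-theoretic union and $\widehat V_i$ is the transitive reduction of $V_i$. Then $\mathcal R=\{R_i\}_{i\in P}$ is a good record of $\mathcal V$; that is, every set of views $\mathcal V'=\{V'_i\}_{i\in P}$ that explains some strongly causal consistent execution and satisfies $R_i\subseteq V'_i$ for all $i\in P$ has $V'_i=V_i$ for all $i\in P$.
   Context: Relations are sets of ordered pairs; $a<_R b$ means $(a,b)\in R$. Partial and total orders are strict (irreflexive, antisymmetric, transitive). $A$ respects $B$ means $B\subseteq A$. $A\mid S$ is the restriction $A\cap(S\times S)$. $\widehat A$ is the (unique) transitive reduction of a partial order $A$ on a finite set. System. There are a finite set $P$ of processes, a finite set $X$ of shared variables and a finite set $O$ of operations. Each operation is a read or a write, performed by one process on one variable. $( *,i,*,* )$ is the set of operations of process $i$, $(\mathrm w,*,*,* )$ the set of all writes, $(\mathrm w,i,*,* )$ the set of writes of process $i$. Put $D_i=( *,i,*,* )\cup(\mathrm w,*,*,* )$. For each $i$ a total order $PO(i)$ on $( *,i,*,* )$ is fixed (independent of the execution), and $PO=\bigcup_i PO(i)$ (program order). Writes write pairwise distinct values. Executions and views. An execution specifies for every read the value it returns: that of some write to the same variable, or the initial default value of the variable. For an execution, a view on $D_i$ is a total order on $D_i$ in which every read returns the value of the last preceding write to the same variable (the default value if there is none). Consequently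 every family of total orders on the sets $D_i$, $i\in P$, is a family of views for exactly one execution. Strong causal order. For $\mathcal V=\{V_i\}_{i\in P}$ with $V_i$ a total order on $D_i$: for a write $w^1$ and a write $w^2$ of process $i$, $(w^1,w^2)\in SCO(\mathcal V)$ iff $(w^1,w^2)\in V_i$. Strong causal consistency. $\mathcal V=\{V_i\}_{i\in P}$ explains a strongly causal consistent execution if for every $i$, $V_i$ is a view on $D_i$ for that execution and $V_i$ respects $SCO(\mathcal V)$ and $PO\mid D_i$. Relations $SCO_i$ and $B_i$. $(w^1,w^2)\in SCO_i(\mathcal V)$ iff $(w^1,w^2)\in SCO(\mathcal V)$ and $w^2$ is a write of some process $j\ne i$. For $w^1\in(\mathrm w,i,*,* )$ and $w^2\in(\mathrm w,j,*,* )$ with $j\neq i$: $(w^1,w^2)\in B_i(\mathcal V)$ iff $(w^1,w^2)\in V_i$ and there is a process $k\notin\{i,j\}$ with $(w^1,w^2)\in V_k$. Records (RnR Model 1). A record of $\mathcal V$ is a family $\mathcal R=\{R_i\}_{i\in P}$ with $R_i\subseteq V_i$. A set of views $\mathcal V'$ certifies a (strongly causal consistent) replay to be valid for $\mathcal R$ if $\mathcal V'$ explains a strongly causal consistent execution and $R_i\subseteq V'_i$ for all $i$. $\mathcal R$ is good if every such $\mathcal V'$ equals $\mathcal V$. *)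

theory Defs
  imports Main
begin

section \<open>Orders\<close>

text \<open>Orders are strict. The library predicate does not confine the relation to its carrier, hence
  the additional conjunct; antisymmetry follows from irreflexivity and transitivity.\<close>

definition total_order_of :: "'a set \<Rightarrow> 'a rel \<Rightarrow> bool" where
  "total_order_of D r \<longleftrightarrow> r \<subseteq> D \<times> D \<and> strict_linear_order_on D r"

definition is_transitive_reduction :: "'a rel \<Rightarrow> 'a rel \<Rightarrow> bool" where
  "is_transitive_reduction T A \<longleftrightarrow> T\<^sup>+ = A\<^sup>+ \<and> (\<forall>T' \<subseteq> T. T'\<^sup>+ = A\<^sup>+ \<longrightarrow> T' = T)"

definition transitive_reduction :: "'a rel \<Rightarrow> 'a rel" where
  "transitive_reduction A = (THE T. is_transitive_reduction T A)"

text \<open>On finite strict partial orders the description above is proper: the transitive reduction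
  exists, is unique, and is the covering relation.\<close>

lemma
  assumes "finite A" "irrefl A" "trans A"
  shows ex1_transitive_reduction: "\<exists>!T. is_transitive_reduction T A"
    and transitive_reduction_eq:
      "transitive_reduction A = {(a, b) \<in> A. \<nexists>c. (a, c) \<in> A \<and> (c, b) \<in> A}"
proof -
  define C where "C = {(a, b) \<in> A. \<nexists>c. (a, c) \<in> A \<and> (c, b) \<in> A}"
  have CA: "C \<subseteq> A" by (auto simp: C_def)
  have closed: "A\<^sup>+ = A" using assms(3) by simp
  define btw where "btw a b = {c. (a, c) \<in> A \<and> (c, b) \<in> A}" for a b
  have fin: "finite (btw a b)" for a b
    by (rule finite_subset[OF _ finite_imageI[OF assms(1), of fst]]) (force simp: btw_def)
  have "(a, b) \<in> C\<^sup>+" if "(a, b) \<in> A" for a b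
    using that
  proof (induction "card (btw a b)" arbitrary: a b rule: less_induct)
    case less
    show ?case
    proof (cases "(a, b) \<in> C")
      case False
      then obtain c where c: "(a, c) \<in> A" "(c, b) \<in> A" using less.prems by (auto simp: C_def)
      have cn: "c \<notin> btw a c" "c \<notin> btw c b" "c \<in> btw a b"
        using c assms(2) by (auto simp: btw_def irrefl_def)
      have "btw a c \<subseteq> btw a b" "btw c b \<subseteq> btw a b"
        using c assms(3) by (auto simp: btw_def dest: transD)
      then have "card (btw a c) < card (btw a b)" "card (btw c b) < card (btw a b)"
        using cn fin by (auto intro!: psubset_card_mono)
      then show ?thesis using less.hyps c by (meson trancl_trans)
    qed auto
  qed
  then have CA': "C\<^sup>+ = A"
    using CA closed trancl_mono by (metis subrelI subset_antisym subsetI)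
  have least: "C \<subseteq> T" if T: "T\<^sup>+ = A" for T
  proof (rule subrelI)
    fix a b assume ab: "(a, b) \<in> C"
    then have "(a, b) \<in> T\<^sup>+" using T CA by auto
    then show "(a, b) \<in> T"
    proof (cases rule: tranclE)
      case (step c)
      then show ?thesis using ab T by (auto simp: C_def dest: r_into_trancl)
    qed
  qed
  have C: "is_transitive_reduction C A"
    using least by (auto simp: is_transitive_reduction_def closed CA')
  have uniq: "T = C" if "is_transitive_reduction T A" for T
    using that least CA' unfolding is_transitive_reduction_def closed by blast
  show "\<exists>!T. is_transitive_reduction T A" using C uniq by blast
  show "transitive_reduction A = {(a, b) \<in> A. \<nexists>c. (a, c) \<in> A \<and> (c, b) \<in> A}"
    unfolding transitive_reduction_def C_def[symmetric] using C uniq by (rule the_equality)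
qed


section \<open>Systems\<close>

text \<open>An operation that is not a write is a read. The field \<open>written\<close> is meaningful on writes only
  and \<open>po\<close> on elements of \<open>procs\<close> only.\<close>

record ('p, 'x, 'o, 'v) memory_system =
  procs :: "'p set"
  variables :: "'x set"
  ops :: "'o set"
  is_write :: "'o \<Rightarrow> bool"
  proc_of :: "'o \<Rightarrow> 'p"
  var_of :: "'o \<Rightarrow> 'x"
  written :: "'o \<Rightarrow> 'v"
  default_val :: "'x \<Rightarrow> 'v"
  po :: "'p \<Rightarrow> 'o rel"

definition ops_of :: "('p, 'x, 'o, 'v) memory_system \<Rightarrow> 'p \<Rightarrow> 'o set" where
  "ops_of S i = {a \<in> ops S. proc_of S a = i}"

definition writes :: "('p, 'x, 'o, 'v) memory_system \<Rightarrow> 'o set" where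
  "writes S = {a \<in> ops S. is_write S a}"

definition reads :: "('p, 'x, 'o, 'v) memory_system \<Rightarrow> 'o set" where
  "reads S = {a \<in> ops S. \<not> is_write S a}"

definition writes_of :: "('p, 'x, 'o, 'v) memory_system \<Rightarrow> 'p \<Rightarrow> 'o set" where
  "writes_of S i = {a \<in> writes S. proc_of S a = i}"

definition D :: "('p, 'x, 'o, 'v) memory_system \<Rightarrow> 'p \<Rightarrow> 'o set" where
  "D S i = ops_of S i \<union> writes S"

definition PO :: "('p, 'x, 'o, 'v) memory_system \<Rightarrow> 'o rel" where
  "PO S = (\<Union>i\<in>procs S. po S i)"

definition wf_system :: "('p, 'x, 'o, 'v) memory_system \<Rightarrow> bool" where
  "wf_system S \<longleftrightarrow>
     finite (procs S) \<and> finite (variables S) \<and> finite (ops S) \<and>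
     proc_of S ` ops S \<subseteq> procs S \<and> var_of S ` ops S \<subseteq> variables S \<and>
     inj_on (written S) (writes S) \<and>
     (\<forall>i\<in>procs S. total_order_of (ops_of S i) (po S i))"


section \<open>Executions and views\<close>

text \<open>An execution is given by the value it returns for each read; its values on other arguments
  are irrelevant.\<close>

definition execution :: "('p, 'x, 'o, 'v) memory_system \<Rightarrow> ('o \<Rightarrow> 'v) \<Rightarrow> bool" where
  "execution S e \<longleftrightarrow>
     (\<forall>r\<in>reads S. (\<exists>w\<in>writes S. var_of S w = var_of S r \<and> e r = written S w)
                 \<or> e r = default_val S (var_of S r))"

definition preceding_writes :: "('p, 'x, 'o, 'v) memory_system \<Rightarrow> 'o rel \<Rightarrow> 'o \<Rightarrow> 'o set" where
  "preceding_writes S U r = {w \<in> writes S. var_of S w = var_of S r \<and> (w, r) \<in> U}"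

definition view :: "('p, 'x, 'o, 'v) memory_system \<Rightarrow> ('o \<Rightarrow> 'v) \<Rightarrow> 'p \<Rightarrow> 'o rel \<Rightarrow> bool" where
  "view S e i U \<longleftrightarrow>
     total_order_of (D S i) U \<and>
     (\<forall>r \<in> reads S \<inter> D S i.
        (preceding_writes S U r = {} \<longrightarrow> e r = default_val S (var_of S r)) \<and>
        (\<forall>w \<in> preceding_writes S U r.
           (\<forall>w' \<in> preceding_writes S U r. w' \<noteq> w \<longrightarrow> (w', w) \<in> U) \<longrightarrow> e r = written S w))"


section \<open>Strong causal consistency\<close>

text \<open>A family indexed by processes is a function, of which only the values on \<open>procs S\<close> matter.\<close>

definition SCO :: "('p, 'x, 'o, 'v) memory_system \<Rightarrow> ('p \<Rightarrow> 'o rel) \<Rightarrow> 'o rel" where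
  "SCO S V = {(w1, w2). w1 \<in> writes S \<and> (\<exists>i\<in>procs S. w2 \<in> writes_of S i \<and> (w1, w2) \<in> V i)}"

definition explains ::
    "('p, 'x, 'o, 'v) memory_system \<Rightarrow> ('p \<Rightarrow> 'o rel) \<Rightarrow> ('o \<Rightarrow> 'v) \<Rightarrow> bool" where
  "explains S V e \<longleftrightarrow>
     (\<forall>i\<in>procs S. view S e i (V i) \<and> SCO S V \<subseteq> V i \<and> Restr (PO S) (D S i) \<subseteq> V i)"

definition explains_scc_execution ::
    "('p, 'x, 'o, 'v) memory_system \<Rightarrow> ('p \<Rightarrow> 'o rel) \<Rightarrow> bool" where
  "explains_scc_execution S V \<longleftrightarrow> (\<exists>e. execution S e \<and> explains S V e)"

definition SCO_except ::
    "('p, 'x, 'o, 'v) memory_system \<Rightarrow> ('p \<Rightarrow> 'o rel) \<Rightarrow> 'p \<Rightarrow> 'o rel" where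
  "SCO_except S V i =
     {(w1, w2) \<in> SCO S V. \<exists>j\<in>procs S. j \<noteq> i \<and> w2 \<in> writes_of S j}"

definition B :: "('p, 'x, 'o, 'v) memory_system \<Rightarrow> ('p \<Rightarrow> 'o rel) \<Rightarrow> 'p \<Rightarrow> 'o rel" where
  "B S V i =
     {(w1, w2). w1 \<in> writes_of S i \<and>
        (\<exists>j\<in>procs S. j \<noteq> i \<and> w2 \<in> writes_of S j \<and> (w1, w2) \<in> V i \<and>
           (\<exists>k\<in>procs S. k \<notin> {i, j} \<and> (w1, w2) \<in> V k))}"


section \<open>Records\<close>

definition is_record ::
    "('p, 'x, 'o, 'v) memory_system \<Rightarrow> ('p \<Rightarrow> 'o rel) \<Rightarrow> ('p \<Rightarrow> 'o rel) \<Rightarrow> bool" where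
  "is_record S V R \<longleftrightarrow> (\<forall>i\<in>procs S. R i \<subseteq> V i)"

definition certifies ::
    "('p, 'x, 'o, 'v) memory_system \<Rightarrow> ('p \<Rightarrow> 'o rel) \<Rightarrow> ('p \<Rightarrow> 'o rel) \<Rightarrow> bool" where
  "certifies S V' R \<longleftrightarrow> explains_scc_execution S V' \<and> (\<forall>i\<in>procs S. R i \<subseteq> V' i)"

definition good_record ::
    "('p, 'x, 'o, 'v) memory_system \<Rightarrow> ('p \<Rightarrow> 'o rel) \<Rightarrow> ('p \<Rightarrow> 'o rel) \<Rightarrow> bool" where
  "good_record S V R \<longleftrightarrow>
     is_record S V R \<and> (\<forall>V'. certifies S V' R \<longrightarrow> (\<forall>i\<in>procs S. V' i = V i))"

end

theory Submission
  imports Defs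
begin

text \<open>Compare the \<open>V\<close>-views with those of a replay \<open>V'\<close> by walking along covering edges; an edge of
  \<open>V i\<close> missing from \<open>V' i\<close> lies in \<open>SCO_except S V i\<close> or in \<open>B S V i\<close>. First,
  \<open>SCO S V \<subseteq> SCO S V'\<close>, by induction on the target: the first missing edge on the way to a write of
  \<open>j\<close> in \<open>V j\<close> is not a strong causal edge by induction, and it is not in \<open>B S V j\<close> because the
  source of such an edge precedes the target in program order. Hence only edges \<open>(a, b)\<close> of some
  \<open>B S V i\<close> can be missing. Then \<open>(b, a)\<close> is in \<open>SCO S V'\<close>, so it is in \<open>V' k\<close> for the third process
  \<open>k\<close> witnessing \<open>(a, b) \<in> V k\<close>; the first missing edge on the way from \<open>a\<close> to \<open>b\<close> in \<open>V k\<close> starts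
  at a write of \<open>k\<close> that follows \<open>a\<close> in \<open>SCO S V'\<close>, and this cannot go on forever.\<close>

lemma transitive_reduction_trancl:
  assumes "finite A" "irrefl A" "trans A"
  shows "(transitive_reduction A)\<^sup>+ = A"
  using theI'[OF ex1_transitive_reduction[OF assms]] \<open>trans A\<close>
  by (simp add: transitive_reduction_def is_transitive_reduction_def)

text \<open>Follow a \<open>T\<close>-path from \<open>a\<close> to \<open>b\<close>: as
  \<open>s\<close> is transitive, the edges before the first one outside \<open>s\<close> compose to
  a pair of \<open>s\<close>. The equalities cover a missing edge at either end of the path.\<close>

lemma first_missing_edge:
  assumes "trans s" "(a, b) \<in> T\<^sup>+" "(a, b) \<notin> s"
  obtains c d where "(c, d) \<in> T" "(c, d) \<notin> s" "a = c \<or> (a, c) \<in> s" "d = b \<or> (d, b) \<in> T\<^sup>+"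
proof -
  have "\<exists>c d. (c, d) \<in> T \<and> (c, d) \<notin> s \<and> (a = c \<or> (a, c) \<in> s) \<and> (d = b \<or> (d, b) \<in> T\<^sup>+)"
    using assms(2,3)
  proof (induction rule: trancl_induct)
    case (base y)
    then show ?case by blast
  next
    case (step y z)
    show ?case
    proof (cases "(a, y) \<in> s")
      case True
      then have "(y, z) \<notin> s" using step.prems \<open>trans s\<close> by (blast dest: transD)
      then show ?thesis using True step.hyps(2) by blast
    next
      case False
      then obtain c d where "(c, d) \<in> T" "(c, d) \<notin> s" "a = c \<or> (a, c) \<in> s"
          "d = y \<or> (d, y) \<in> T\<^sup>+"
        using step.IH by blast
      then show ?thesis using step.hyps(2) by (blast intro: trancl_into_trancl)
    qed
  qed
  then show ?thesis using that by blast
qed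

lemma total_order_of_subset_eq:
  assumes "total_order_of X r" "total_order_of X s" "r \<subseteq> s"
  shows "s = r"
proof (rule antisym[OF subrelI assms(3)])
  fix a b assume ab: "(a, b) \<in> s"
  have s: "irrefl s" "trans s" "s \<subseteq> X \<times> X"
    using assms(2) by (auto simp: total_order_of_def strict_linear_order_on_def)
  then have "a \<noteq> b" "(b, a) \<notin> s"
    using ab by (meson irreflD transD)+
  moreover have "a \<in> X" "b \<in> X" using ab s(3) by auto
  ultimately show "(a, b) \<in> r"
    using assms(1,3) by (auto simp: total_order_of_def strict_linear_order_on_def total_on_def)
qed

lemma explains_total_order:
  assumes "explains S V e" "i \<in> procs S"
  shows "total_order_of (D S i) (V i)"
  using assms by (simp add: explains_def view_def)

lemma
  assumes "explains S V e" "i \<in> procs S"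
  shows explains_trans: "trans (V i)"
    and explains_irrefl: "irrefl (V i)"
    and explains_total: "total_on (D S i) (V i)"
    and explains_carrier: "V i \<subseteq> D S i \<times> D S i"
  using explains_total_order[OF assms]
  by (auto simp: total_order_of_def strict_linear_order_on_def)

lemma explains_finite:
  assumes "wf_system S" "explains S V e" "i \<in> procs S"
  shows "finite (V i)"
proof -
  have "finite (D S i)"
    using assms(1) by (simp add: wf_system_def D_def ops_of_def writes_def)
  then show ?thesis
    using explains_carrier[OF assms(2,3)] by (meson finite_SigmaI finite_subset)
qed

lemma explains_trancl_reduction:
  assumes "wf_system S" "explains S V e" "i \<in> procs S"
  shows "(transitive_reduction (V i))\<^sup>+ = V i"
  by (rule transitive_reduction_trancl[OF explains_finite[OF assms] explains_irrefl[OF assms(2,3)]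
        explains_trans[OF assms(2,3)]])

lemma SCO_subset_view:
  assumes "explains S V e" "i \<in> procs S"
  shows "SCO S V \<subseteq> V i"
  using assms by (simp add: explains_def)

text \<open>Strong causal order lies inside every single view, a finite strict order. This justifies
  induction along it in both directions.\<close>

lemma finite_acyclic_SCO:
  assumes "wf_system S" "explains S V e"
  shows "finite (SCO S V) \<and> acyclic (SCO S V)"
proof (cases "procs S = {}")
  case True
  then show ?thesis by (simp add: SCO_def acyclic_def)
next
  case False
  then obtain i where i: "i \<in> procs S" by blast
  have "acyclic (V i)"
    using explains_trans[OF assms(2) i] explains_irrefl[OF assms(2) i]
    by (simp add: acyclic_irrefl)
  then show ?thesis
    using explains_finite[OF assms i] SCO_subset_view[OF assms(2) i]
    by (auto intro: finite_subset acyclic_subset)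
qed

text \<open>Program order is total on the operations of one process and fixed by the system, so
  original and replay agree there.\<close>

lemma explains_po:
  assumes "wf_system S" "explains S V e" "explains S V' e'" "i \<in> procs S"
    and "a \<in> ops_of S i" "b \<in> ops_of S i" "(a, b) \<in> V i"
  shows "(a, b) \<in> V' i"
proof -
  have po: "total_order_of (ops_of S i) (po S i)"
    using assms(1,4) by (simp add: wf_system_def)
  have sub: "po S i \<subseteq> U i" if "explains S U f" for U f
  proof -
    have "po S i \<subseteq> Restr (PO S) (D S i)"
      using po assms(4) by (auto simp: total_order_of_def PO_def D_def)
    also have "\<dots> \<subseteq> U i" using that assms(4) unfolding explains_def by blast
    finally show ?thesis .
  qed
  have "a \<noteq> b" "(b, a) \<notin> V i"
    using assms(7) explains_irrefl[OF assms(2,4)] explains_trans[OF assms(2,4)]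
    by (meson irreflD transD)+
  then have "(a, b) \<in> po S i"
    using po assms(5,6) sub[OF assms(2)]
    by (auto simp: total_order_of_def strict_linear_order_on_def total_on_def)
  then show ?thesis using sub[OF assms(3)] by blast
qed

text \<open>The replay may explain a different execution: \<open>e\<close> and \<open>e'\<close> are
  unrelated.\<close>

locale replay =
  fixes S :: "('p, 'x, 'o, 'v) memory_system"
    and V V' :: "'p \<Rightarrow> 'o rel"
    and e e' :: "'o \<Rightarrow> 'v"
  assumes wf: "wf_system S"
    and expl: "explains S V e"
    and expl': "explains S V' e'"
    and recorded: "\<And>i. i \<in> procs S \<Longrightarrow>
          transitive_reduction (V i) - (SCO_except S V i \<union> PO S \<union> B S V i) \<subseteq> V' i"
begin

lemma missing_edge_cases:
  assumes i: "i \<in> procs S" and cd: "(c, d) \<in> transitive_reduction (V i)" "(c, d) \<notin> V' i"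
  shows "(c, d) \<in> SCO_except S V i \<or> (c, d) \<in> B S V i"
proof -
  have "(c, d) \<in> V i"
    using cd(1) explains_trancl_reduction[OF wf expl i] by (metis r_into_trancl')
  then have "(c, d) \<notin> PO S"
    using cd(2) explains_carrier[OF expl i] expl' i by (auto simp: explains_def)
  then show ?thesis using recorded[OF i] cd by blast
qed

lemma SCO_subset: "SCO S V \<subseteq> SCO S V'"
proof (rule subrelI)
  have "wf (SCO S V)"
    using finite_acyclic_SCO[OF wf expl] finite_acyclic_wf by blast
  then show "(w1, w2) \<in> SCO S V'" if "(w1, w2) \<in> SCO S V" for w1 w2
    using that
  proof (induction w2 arbitrary: w1 rule: wf_induct_rule)
    case (less w2)
    then obtain j where w1: "w1 \<in> writes S" and j: "j \<in> procs S"
      and w2: "w2 \<in> writes_of S j" and w12: "(w1, w2) \<in> V j"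
      by (auto simp: SCO_def)
    note red = explains_trancl_reduction[OF wf expl j]
    have "(w1, w2) \<in> V' j"
    proof (rule ccontr)
      assume missing: "(w1, w2) \<notin> V' j"
      obtain c d where cd: "(c, d) \<in> transitive_reduction (V j)" "(c, d) \<notin> V' j"
        and c: "w1 = c \<or> (w1, c) \<in> V' j" and d: "d = w2 \<or> (d, w2) \<in> V j"
        by (rule first_missing_edge[OF explains_trans[OF expl' j] _ missing,
              of "transitive_reduction (V j)"]) (use w12 red in auto)
      from missing_edge_cases[OF j cd] show False
      proof
        assume "(c, d) \<in> SCO_except S V j"
        \<comment> \<open>\<open>d\<close> is a write of a process other than \<open>j\<close>,
          hence not \<open>w2\<close>; it strictly precedes \<open>w2\<close> in
          \<open>SCO S V\<close>, so the induction hypothesis applies to target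
          \<open>d\<close>.\<close>
        then have "(c, d) \<in> SCO S V" "d \<in> writes S" "d \<noteq> w2"
          using w2 by (auto simp: SCO_except_def writes_of_def)
        moreover from this have "(d, w2) \<in> SCO S V"
          using d j w2 by (auto simp: SCO_def)
        ultimately have "(c, d) \<in> SCO S V'" using less.IH by blast
        then show False using cd(2) SCO_subset_view[OF expl' j] by blast
      next
        assume "(c, d) \<in> B S V j"
        then have "c \<in> ops_of S j" by (auto simp: B_def writes_of_def writes_def ops_of_def)
        moreover have "w2 \<in> ops_of S j" using w2 by (auto simp: writes_of_def writes_def ops_of_def)
        moreover have "(c, w2) \<in> V j"
          using cd(1) d red explains_trans[OF expl j] by (metis r_into_trancl' transD)
        ultimately have "(c, w2) \<in> V' j" by (rule explains_po[OF wf expl expl' j])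
        then show False using c missing explains_trans[OF expl' j] by (meson transD)
      qed
    qed
    then show ?case using w1 j w2 by (auto simp: SCO_def)
  qed
qed

lemma missing_edge_B:
  assumes "i \<in> procs S" "(c, d) \<in> transitive_reduction (V i)" "(c, d) \<notin> V' i"
  shows "(c, d) \<in> B S V i"
  using missing_edge_cases[OF assms] assms(3) SCO_subset SCO_subset_view[OF expl' assms(1)]
  by (auto simp: SCO_except_def)

lemma B_subset:
  assumes "i \<in> procs S"
  shows "B S V i \<subseteq> V' i"
proof (rule subrelI)
  \<comment> \<open>Well-foundedness of the converse lets the induction assume the claim for all
    sources later than \<open>a\<close>, simultaneously for all processes.\<close>
  have "wf ((SCO S V')\<inverse>)"
    using finite_acyclic_SCO[OF wf expl'] finite_acyclic_wf_converse by blast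
  then show "(a, b) \<in> V' i" if "(a, b) \<in> B S V i" for a b
    using that assms
  proof (induction a arbitrary: i b rule: wf_induct_rule)
    case (less a)
    note i = less.prems(2)
    from less.prems(1) obtain k where a: "a \<in> writes_of S i" and b: "b \<in> writes S"
      and ab: "(a, b) \<in> V i" and k: "k \<in> procs S" "k \<noteq> i" "(a, b) \<in> V k"
      by (auto simp: B_def writes_of_def)
    show ?case
    proof (rule ccontr)
      assume missing: "(a, b) \<notin> V' i"
      have "a \<noteq> b" using ab explains_irrefl[OF expl i] by (auto simp: irrefl_def)
      moreover have "a \<in> D S i" "b \<in> D S i" using ab explains_carrier[OF expl i] by auto
      ultimately have "(b, a) \<in> V' i"
        using missing explains_total[OF expl' i] by (auto simp: total_on_def)
      \<comment> \<open>Since \<open>a\<close> is a write of \<open>i\<close> itself, the reversal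
        in \<open>V' i\<close> is strong causal and spreads to every view of the replay.\<close>
      then have "(b, a) \<in> SCO S V'" using a b i by (auto simp: SCO_def)
      then have "(b, a) \<in> V' k" using SCO_subset_view[OF expl' k(1)] by blast
      then have missing_k: "(a, b) \<notin> V' k"
        using explains_irrefl[OF expl' k(1)] explains_trans[OF expl' k(1)]
        by (meson irreflD transD)
      obtain c d where cd: "(c, d) \<in> transitive_reduction (V k)" "(c, d) \<notin> V' k"
        and c: "a = c \<or> (a, c) \<in> V' k"
        by (rule first_missing_edge[OF explains_trans[OF expl' k(1)] _ missing_k,
              of "transitive_reduction (V k)"])
          (use k(3) explains_trancl_reduction[OF wf expl k(1)] in auto)
      have cdB: "(c, d) \<in> B S V k" by (rule missing_edge_B[OF k(1) cd])
      then have "c \<in> writes_of S k" by (auto simp: B_def)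
      \<comment> \<open>\<open>k \<noteq> i\<close> excludes \<open>a = c\<close>, so
        \<open>c\<close> is a strictly later source.\<close>
      then have "(a, c) \<in> SCO S V'"
        using a c k(1,2) by (auto simp: SCO_def writes_of_def)
      then show False using less.IH cdB k(1) cd(2) by blast
    qed
  qed
qed

lemma views_eq:
  assumes i: "i \<in> procs S"
  shows "V' i = V i"
proof -
  \<comment> \<open>No covering edge can be missing: it would lie in \<open>B S V i\<close>, which
    \<open>V' i\<close> contains.\<close>
  have "transitive_reduction (V i) \<subseteq> V' i"
    using missing_edge_B[OF i] B_subset[OF i] by auto
  then have "(transitive_reduction (V i))\<^sup>+ \<subseteq> V' i"
    using explains_trans[OF expl' i] by (metis trancl_id trancl_mono_subset)
  then have "V i \<subseteq> V' i" by (simp only: explains_trancl_reduction[OF wf expl i])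
  then show ?thesis
    by (rule total_order_of_subset_eq[OF explains_total_order[OF expl i]
          explains_total_order[OF expl' i]])
qed

end

theorem theorem5p3:
  fixes S :: "('p, 'x, 'o, 'v) memory_system"
    and V R :: "'p \<Rightarrow> 'o rel"
  assumes "wf_system S"
    and "explains_scc_execution S V"
    and "\<And>i. i \<in> procs S \<Longrightarrow>
           R i = transitive_reduction (V i) - (SCO_except S V i \<union> PO S \<union> B S V i)"
  shows "good_record S V R"
proof -
  from assms(2) obtain e where e: "explains S V e" by (auto simp: explains_scc_execution_def)
  have "R i \<subseteq> V i" if "i \<in> procs S" for i
    using assms(3)[OF that] explains_trancl_reduction[OF assms(1) e that]
    by (metis Diff_subset r_into_trancl' subsetD subrelI)
  moreover have "V' i = V i" if "certifies S V' R" "i \<in> procs S" for V' i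
  proof -
    from that(1) obtain e' where e': "explains S V' e'"
      by (auto simp: certifies_def explains_scc_execution_def)
    interpret replay S V V' e e'
      using assms(1,3) e e' that(1) by unfold_locales (auto simp: certifies_def)
    show ?thesis using that(2) by (rule views_eq)
  qed
  ultimately show ?thesis by (auto simp: good_record_def is_record_def)
qed

end
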